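(* Let $\mathcal{S}_4=\{|\xi_i\rangle\}_{i=1}^8\subset\mathbb{C}^4\otimes\mathbb{C}^4$ be the set of mutually orthogonal states (given up to normalization) shared by Alice (first factor) and Bob (second factor), where $\{|\mathbf{0}\rangle,|\mathbf{1}\rangle,|\mathbf{2}\rangle,|\mathbf{3}\rangle\}$ is the standard basis of $\mathbb{C}^4$ and $$|\xi_1\rangle=|\mathbf{0}\mathbf{0}\rangle+|\mathbf{0}\mathbf{2}\rangle+|\mathbf{3}\mathbf{1}\rangle-|\mathbf{3}\mathbf{3}\rangle,\qquad |\xi_2\rangle=|\mathbf{0}\mathbf{0}\rangle-|\mathbf{0}\mathbf{2}\rangle-|\mathbf{3}\mathbf{1}\rangle-|\mathbf{3}\mathbf{3}\rangle,$$ $$|\xi_3\rangle=|\mathbf{0}\mathbf{1}\rangle-|\mathbf{3}\mathbf{2}\rangle-|\mathbf{3}\mathbf{0}\rangle-|\mathbf{0}\mathbf{3}\rangle,\qquad |\xi_4\rangle=|\mathbf{0}\mathbf{1}\rangle+|\mathbf{3}\mathbf{2}\rangle+|\mathbf{3}\mathbf{0}\rangle-|\mathbf{0}\mathbf{3}\rangle,$$ $$|\xi_5\rangle=|\mathbf{1}\mathbf{0}\rangle+|\mathbf{1}\mathbf{2}\rangle+|\mathbf{2}\mathbf{1}\rangle-|\mathbf{2}\mathbf{3}\rangle,\qquad |\xi_6\rangle=|\mathbf{1}\mathbf{0}\rangle+|\mathbf{1}\mathbf{2}\rangle-|\mathbf{2}\mathbf{1}\rangle+|\mathbf{2}\mathbf{3}\rangle,$$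 $$|\xi_7\rangle=|\mathbf{1}\mathbf{1}\rangle-|\mathbf{2}\mathbf{2}\rangle+|\mathbf{2}\mathbf{0}\rangle+|\mathbf{1}\mathbf{3}\rangle,\qquad |\xi_8\rangle=|\mathbf{1}\mathbf{1}\rangle-|\mathbf{2}\mathbf{2}\rangle-|\mathbf{2}\mathbf{0}\rangle-|\mathbf{1}\mathbf{3}\rangle.$$ Then $\mathcal{S}_4$ can be deterministically converted to a locally unmarkable set of states via local orthogonality preserving measurements (OPMs).
   Context: All states are understood up to normalization. LOCC: protocols in which spatially separated parties perform local quantum operations on their own systems and exchange classical messages. Locally (un)markable: for a set of $m$ mutually orthogonal states $\{|\chi_1\rangle,\dots,|\chi_m\rangle\}$, suppose the parties share all $m$ states in an unknown order, i.e. they share $|\chi_{\pi(1)}\rangle\otimes\cdots\otimes|\chi_{\pi(m)}\rangle$ for an unknown permutation $\pi$ of $\{1,\dots,m\}$, each party holding its share of all $m$ states. The set is locally markable if some LOCC protocol identifies $\pi$ with certainty; otherwise it is locally unmarkable. Local OPM: a measurement $\{M_a\}$ (one operator $M_a$ per outcome, $\sum_a M_a^\dagger M_a=\mathbb{I}$) performed by one party on its own system such that, for each outcome, the nonzero post-measurement states of the set are mutually orthogonal (some states of the set may be mapped to zero, i.e. eliminated). "Deterministically converted via local OPMs to a set with a property": there are local OPMs, performed by one or more of the parties, such that for every combination of outcomes the set of nonzero post-measurement states has that property. *)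

theory Defs
  imports "Jordan_Normal_Form.Schur_Decomposition" "HOL-Combinatorics.Permutations"
begin

text \<open>
  A vector of the bipartite space, with components \<open>\<psi> i j\<close> in the basis \<open>|i>|j>\<close> (\<open>i\<close> for Alice,
  \<open>j\<close> for Bob), is represented by its coefficient matrix.  Alice's operator \<open>A\<close> and Bob's operator
  \<open>B\<close> then act by \<open>\<psi> \<mapsto> A * \<psi> * B\<^sup>T\<close>.  States are nonzero vectors, not necessarily normalized.
\<close>

type_synonym bistate = "complex mat"

datatype party = Alice | Bob

definition state_inner :: "bistate \<Rightarrow> bistate \<Rightarrow> complex" where
  "state_inner \<phi> \<psi> = (\<Sum>i<dim_row \<phi>. \<Sum>j<dim_col \<phi>. cnj (\<phi> $$ (i, j)) * \<psi> $$ (i, j))"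

definition state_norm_sq :: "bistate \<Rightarrow> real" where
  "state_norm_sq \<psi> = (\<Sum>i<dim_row \<psi>. \<Sum>j<dim_col \<psi>. (cmod (\<psi> $$ (i, j)))\<^sup>2)"

text \<open>
  Sets of states are given by enumerating lists.  The local dimensions are \<open>d Alice\<close> and \<open>d Bob\<close>.
  Mutual orthogonality of nonzero vectors makes the listed states distinct.
\<close>

definition orthogonal_states :: "(party \<Rightarrow> nat) \<Rightarrow> bistate list \<Rightarrow> bool" where
  "orthogonal_states d \<chi>s \<longleftrightarrow>
     (\<forall>\<chi>\<in>set \<chi>s. \<chi> \<in> carrier_mat (d Alice) (d Bob) \<and> \<chi> \<noteq> 0\<^sub>m (d Alice) (d Bob)) \<and>
     (\<forall>i<length \<chi>s. \<forall>j<length \<chi>s. i \<noteq> j \<longrightarrow> state_inner (\<chi>s ! i) (\<chi>s ! j) = 0)"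

fun apply_local :: "party \<Rightarrow> complex mat \<Rightarrow> bistate \<Rightarrow> bistate" where
  "apply_local Alice M \<psi> = M * \<psi>"
| "apply_local Bob M \<psi> = \<psi> * transpose_mat M"

text \<open>
  The operators may be rectangular, so that a local operation can adjoin or discard ancillary
  systems.
\<close>

definition local_measurement :: "nat \<Rightarrow> complex mat list \<Rightarrow> bool" where
  "local_measurement n Ms \<longleftrightarrow>
     (\<forall>M\<in>set Ms. dim_col M = n) \<and>
     foldr (\<lambda>M S. mat_adjoint M * M + S) Ms (0\<^sub>m n n) = 1\<^sub>m n"

text \<open>
  In a node \<open>Measure p bs\<close> party \<open>p\<close> performs the measurement whose operators are the first
  components of \<open>bs\<close> and announces the outcome; the protocol continues as prescribed for that
  outcome.  One Kraus operator per branch is no restriction: for an operation with several Kraus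
  operators per outcome, the branches may carry equal continuations.
\<close>

datatype 'r locc = Output 'r | Measure party "(complex mat \<times> 'r locc) list"

inductive locc_protocol :: "(party \<Rightarrow> nat) \<Rightarrow> 'r locc \<Rightarrow> bool" where
  "locc_protocol d (Output r)"
| "local_measurement (d p) (map fst bs) \<Longrightarrow>
   (\<And>M T. (M, T) \<in> set bs \<Longrightarrow> locc_protocol (d(p := dim_row M)) T) \<Longrightarrow>
   locc_protocol d (Measure p bs)"

text \<open>
  Born's rule: the squared norms of the unnormalized final states, summed over all branches that
  end with output \<open>r\<close>, relative to the squared norm of the initial state.
\<close>

fun output_weight :: "'r locc \<Rightarrow> bistate \<Rightarrow> 'r \<Rightarrow> real" where
  "output_weight (Output s) \<psi> r = (if s = r then state_norm_sq \<psi> else 0)"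
| "output_weight (Measure p bs) \<psi> r =
     (\<Sum>(M, T)\<leftarrow>bs. output_weight T (apply_local p M \<psi>) r)"

definition output_prob :: "'r locc \<Rightarrow> bistate \<Rightarrow> 'r \<Rightarrow> real" where
  "output_prob T \<psi> r = output_weight T \<psi> r / state_norm_sq \<psi>"

text \<open>
  The Kronecker product of coefficient matrices is the coefficient matrix of the tensor product of
  the two states with the factors regrouped as Alice-Alice : Bob-Bob.
\<close>

definition kron :: "complex mat \<Rightarrow> complex mat \<Rightarrow> complex mat" where
  "kron A B = mat (dim_row A * dim_row B) (dim_col A * dim_col B)
     (\<lambda>(i, j). A $$ (i div dim_row B, j div dim_col B) * B $$ (i mod dim_row B, j mod dim_col B))"

definition shuffled_state :: "bistate list \<Rightarrow> (nat \<Rightarrow> nat) \<Rightarrow> bistate" where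
  "shuffled_state \<chi>s \<pi> = foldr kron (map (\<lambda>i. \<chi>s ! \<pi> i) [0..<length \<chi>s]) (1\<^sub>m 1)"

definition locally_markable :: "(party \<Rightarrow> nat) \<Rightarrow> bistate list \<Rightarrow> bool" where
  "locally_markable d \<chi>s \<longleftrightarrow>
     (\<exists>T. locc_protocol (\<lambda>p. d p ^ length \<chi>s) T \<and>
        (\<forall>\<pi>. \<pi> permutes {..<length \<chi>s} \<longrightarrow> output_prob T (shuffled_state \<chi>s \<pi>) \<pi> = 1))"

definition locally_unmarkable :: "(party \<Rightarrow> nat) \<Rightarrow> bistate list \<Rightarrow> bool" where
  "locally_unmarkable d \<chi>s \<longleftrightarrow> orthogonal_states d \<chi>s \<and> \<not> locally_markable d \<chi>s"

definition post_states :: "party \<Rightarrow> complex mat \<Rightarrow> bistate list \<Rightarrow> bistate list" where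
  "post_states p M \<chi>s =
     filter (\<lambda>\<psi>. \<psi> \<noteq> 0\<^sub>m (dim_row \<psi>) (dim_col \<psi>)) (map (apply_local p M) \<chi>s)"

definition local_opm ::
  "(party \<Rightarrow> nat) \<Rightarrow> party \<Rightarrow> complex mat list \<Rightarrow> bistate list \<Rightarrow> bool" where
  "local_opm d p Ms \<chi>s \<longleftrightarrow>
     local_measurement (d p) Ms \<and>
     (\<forall>M\<in>set Ms. dim_row M = d p \<and> orthogonal_states d (post_states p M \<chi>s))"

text \<open>
  The measurements in \<open>ms\<close> are performed one after the other, each being orthogonality preserving
  on every set of states that the preceding outcomes can leave.
\<close>

fun converts_via :: "(party \<Rightarrow> nat) \<Rightarrow> (bistate list \<Rightarrow> bool) \<Rightarrow>
    (party \<times> complex mat list) list \<Rightarrow> bistate list \<Rightarrow> bool" where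
  "converts_via d P [] \<chi>s \<longleftrightarrow> P \<chi>s"
| "converts_via d P ((p, Ms) # ms) \<chi>s \<longleftrightarrow>
     local_opm d p Ms \<chi>s \<and> (\<forall>M\<in>set Ms. converts_via d P ms (post_states p M \<chi>s))"

definition deterministically_convertible ::
  "(party \<Rightarrow> nat) \<Rightarrow> (bistate list \<Rightarrow> bool) \<Rightarrow> bistate list \<Rightarrow> bool" where
  "deterministically_convertible d P \<chi>s \<longleftrightarrow> (\<exists>ms. ms \<noteq> [] \<and> converts_via d P ms \<chi>s)"

definition ket :: "nat \<Rightarrow> nat \<Rightarrow> bistate" where
  "ket a b = mat 4 4 (\<lambda>(i, j). if i = a \<and> j = b then 1 else 0)"

definition S4 :: "bistate list" where
  "S4 =
    [ket 0 0 + ket 0 2 + ket 3 1 - ket 3 3,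
     ket 0 0 - ket 0 2 - ket 3 1 - ket 3 3,
     ket 0 1 - ket 3 2 - ket 3 0 - ket 0 3,
     ket 0 1 + ket 3 2 + ket 3 0 - ket 0 3,
     ket 1 0 + ket 1 2 + ket 2 1 - ket 2 3,
     ket 1 0 + ket 1 2 - ket 2 1 + ket 2 3,
     ket 1 1 - ket 2 2 + ket 2 0 + ket 1 3,
     ket 1 1 - ket 2 2 - ket 2 0 - ket 1 3]"

end

theory Submission
  imports Defs "HOL-Analysis.L2_Norm"
begin

text \<open>
  Alice projects onto the span of basis vectors \<open>0, 3\<close> or \<open>1, 2\<close>, and then Bob onto \<open>0, 1\<close> or
  \<open>2, 3\<close>.  Every pair of outcomes leaves four states forming a Bell basis of two qubits.

  The 24 orderings of a Bell basis are maximally entangled states \<open>\<psi>\<close> of rank 16, with squared norm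
  16.  Their coefficient matrices are partial isometries with the same initial and final
  projections \<open>P\<close>, \<open>Q\<close>, so on a branch acting by \<open>A\<close> and \<open>B\<close> the weight \<open>\<parallel>A \<psi> B\<^sup>T\<parallel>\<^sup>2\<close> is at
  most \<open>\<parallel>A P\<parallel>\<^sup>2 \<parallel>B Q\<parallel>\<^sup>2\<close> in Frobenius norm, whatever \<open>\<psi>\<close> is.  Summed over all branches of an LOCC
  protocol, these products give \<open>\<parallel>P\<parallel>\<^sup>2 \<parallel>Q\<parallel>\<^sup>2 = 16 \<cdot> 16\<close>, whereas perfect identification needs
  \<open>24 \<cdot> 16\<close>.
\<close>

section \<open>Frobenius norm\<close>

lemma mat_adjoint_dim [simp]:
  "dim_row (mat_adjoint A) = dim_col A" "dim_col (mat_adjoint A) = dim_row A"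
  by (simp_all add: mat_adjoint_def)

lemma mat_adjoint_carrier [simp]: "A \<in> carrier_mat m n \<Longrightarrow> mat_adjoint A \<in> carrier_mat n m"
  by auto

lemma mat_adjoint_index [simp]:
  assumes "i < dim_col A" "j < dim_row A"
  shows "mat_adjoint (A :: complex mat) $$ (i, j) = cnj (A $$ (j, i))"
  using assms by (simp add: mat_adjoint_def mat_of_rows_index vec_index_conjugate)

lemma mult_mat_index:
  assumes "A \<in> carrier_mat m n" "B \<in> carrier_mat n l" "i < m" "j < l"
  shows "(A * B) $$ (i, j) = (\<Sum>k<n. A $$ (i, k) * B $$ (k, j))"
  using assms by (auto simp: scalar_prod_def atLeast0LessThan)

lemma mat_adjoint_mult:
  fixes A B :: "complex mat"
  assumes A: "A \<in> carrier_mat m n" and B: "B \<in> carrier_mat n l"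
  shows "mat_adjoint (A * B) = mat_adjoint B * mat_adjoint A"
proof (rule eq_matI)
  fix i j assume "i < dim_row (mat_adjoint B * mat_adjoint A)" "j < dim_col (mat_adjoint B * mat_adjoint A)"
  then have ij: "i < l" "j < m" using A B by auto
  have "mat_adjoint (A * B) $$ (i, j) = cnj (\<Sum>k<n. A $$ (j, k) * B $$ (k, i))"
    using A B ij by (subst mat_adjoint_index) (auto simp: mult_mat_index[OF A B] simp del: index_mult_mat(1))
  also have "\<dots> = (\<Sum>k<n. mat_adjoint B $$ (i, k) * mat_adjoint A $$ (k, j))"
    using A B ij by (auto simp: mult.commute intro!: sum.cong)
  also have "\<dots> = (mat_adjoint B * mat_adjoint A) $$ (i, j)"
    using ij by (rule mult_mat_index[symmetric, OF mat_adjoint_carrier[OF B] mat_adjoint_carrier[OF A]])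
  finally show "mat_adjoint (A * B) $$ (i, j) = (mat_adjoint B * mat_adjoint A) $$ (i, j)" .
qed auto

section \<open>Squared Frobenius norms of products\<close>

lemma state_norm_sq_nonneg: "0 \<le> state_norm_sq A"
  by (simp add: state_norm_sq_def sum_nonneg)

lemma state_norm_sq_transpose: "state_norm_sq (transpose_mat A) = state_norm_sq A"
  unfolding state_norm_sq_def by (subst sum.swap) simp

text \<open>The right-hand side is the trace of \<open>A * mat_adjoint A\<close>, so equal Gram
  products give equal norms.\<close>

lemma state_norm_sq_eq_diag:
  "complex_of_real (state_norm_sq A) = (\<Sum>i<dim_row A. (A * mat_adjoint A) $$ (i, i))"
proof -
  have "(A * mat_adjoint A) $$ (i, i) = (\<Sum>k<dim_col A. complex_of_real ((cmod (A $$ (i, k)))\<^sup>2))"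
    if "i < dim_row A" for i
    using that by (subst mult_mat_index[where n = "dim_col A"])
      (auto simp: complex_norm_square simp del: of_real_power intro!: sum.cong)
  then show ?thesis by (simp add: state_norm_sq_def)
qed

text \<open>In X U U^* X^* the middle product U U^* is absorbed by \<open>X\<close>, which leaves X
  X^* and hence the same trace. Absorption is asked for instead of U U^* = 1 because the Bell states
  here fill only two of the four dimensions of each party.\<close>

lemma state_norm_sq_mult_coisometry:
  assumes X: "X \<in> carrier_mat l m" and U: "U \<in> carrier_mat m n"
    and absorb: "X * (U * mat_adjoint U) = X"
  shows "state_norm_sq (X * U) = state_norm_sq X"
proof -
  have "(X * U) * mat_adjoint (X * U) = (X * U) * (mat_adjoint U * mat_adjoint X)"
    using mat_adjoint_mult[OF X U] by simp
  also have "\<dots> = X * U * mat_adjoint U * mat_adjoint X"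
    using X U by (intro assoc_mult_mat[symmetric]) auto
  also have "X * U * mat_adjoint U = X * (U * mat_adjoint U)"
    using X U by (intro assoc_mult_mat) auto
  also have "X * (U * mat_adjoint U) = X" by (rule absorb)
  finally have "(X * U) * mat_adjoint (X * U) = X * mat_adjoint X" .
  then have "complex_of_real (state_norm_sq (X * U)) = complex_of_real (state_norm_sq X)"
    by (simp add: state_norm_sq_eq_diag)
  then show ?thesis by (simp only: of_real_eq_iff)
qed

text \<open>Cauchy-Schwarz bounds every entry of the product by the norms of a row of
  \<open>A\<close> and a column of \<open>B\<close>; summing over both indices separates the
  factors.\<close>

lemma state_norm_sq_mult_le:
  assumes A: "A \<in> carrier_mat l m" and B: "B \<in> carrier_mat m n"
  shows "state_norm_sq (A * B) \<le> state_norm_sq A * state_norm_sq B"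
proof -
  let ?a = "\<lambda>i. \<Sum>k<m. (cmod (A $$ (i, k)))\<^sup>2" and ?b = "\<lambda>j. \<Sum>k<m. (cmod (B $$ (k, j)))\<^sup>2"
  have entry: "(cmod ((A * B) $$ (i, j)))\<^sup>2 \<le> ?a i * ?b j" if ij: "i < l" "j < n" for i j
  proof -
    have "cmod ((A * B) $$ (i, j)) \<le> (\<Sum>k<m. \<bar>cmod (A $$ (i, k))\<bar> * \<bar>cmod (B $$ (k, j))\<bar>)"
      unfolding mult_mat_index[OF A B ij] by (rule order_trans[OF norm_sum]) (simp add: norm_mult)
    also have "\<dots> \<le> sqrt (?a i) * sqrt (?b j)"
      using L2_set_mult_ineq unfolding L2_set_def .
    finally have "(cmod ((A * B) $$ (i, j)))\<^sup>2 \<le> (sqrt (?a i) * sqrt (?b j))\<^sup>2"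
      by (rule power_mono) simp
    then show ?thesis by (simp add: power_mult_distrib sum_nonneg)
  qed
  have "state_norm_sq (A * B) = (\<Sum>i<l. \<Sum>j<n. (cmod ((A * B) $$ (i, j)))\<^sup>2)"
    unfolding state_norm_sq_def using A B by simp
  also have "\<dots> \<le> (\<Sum>i<l. \<Sum>j<n. ?a i * ?b j)"
    by (intro sum_mono entry) auto
  also have "\<dots> = (\<Sum>i<l. ?a i) * (\<Sum>j<n. ?b j)" by (simp add: sum_product)
  also have "(\<Sum>j<n. ?b j) = state_norm_sq B"
    using B by (subst sum.swap) (simp add: state_norm_sq_def)
  finally show ?thesis using A by (simp add: state_norm_sq_def)
qed

text \<open>This is the trace of X^* G X. Being additive in \<open>G\<close>, it turns the
  completeness relation of a measurement into an identity between squared norms.\<close>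

definition herm_form :: "complex mat \<Rightarrow> complex mat \<Rightarrow> complex" where
  "herm_form G X = (\<Sum>k<dim_col X. \<Sum>i<dim_row X. \<Sum>j<dim_row X.
     cnj (X $$ (i, k)) * G $$ (i, j) * X $$ (j, k))"

lemma herm_form_gram:
  assumes M: "M \<in> carrier_mat m n" and X: "X \<in> carrier_mat n l"
  shows "herm_form (mat_adjoint M * M) X = complex_of_real (state_norm_sq (M * X))"
proof -
  have gram: "(mat_adjoint M * M) $$ (i, j) = (\<Sum>r<m. cnj (M $$ (r, i)) * M $$ (r, j))"
    if "i < n" "j < n" for i j
    using that M by (subst mult_mat_index[OF mat_adjoint_carrier[OF M] M]) auto
  have "complex_of_real (state_norm_sq (M * X)) =
      (\<Sum>r<m. \<Sum>k<l. cnj ((M * X) $$ (r, k)) * (M * X) $$ (r, k))"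
    using M X by (simp add: state_norm_sq_def complex_norm_square mult.commute del: of_real_power index_mult_mat(1))
  also have "\<dots> = (\<Sum>k<l. \<Sum>r<m. cnj ((M * X) $$ (r, k)) * (M * X) $$ (r, k))"
    by (rule sum.swap)
  also have "\<dots> = (\<Sum>k<l. \<Sum>i<n. \<Sum>j<n.
      cnj (X $$ (i, k)) * (\<Sum>r<m. cnj (M $$ (r, i)) * M $$ (r, j)) * X $$ (j, k))"
  proof (rule sum.cong[OF refl])
    fix k assume "k \<in> {..<l}"
    then have k: "k < l" by simp
    have "(\<Sum>r<m. cnj ((M * X) $$ (r, k)) * (M * X) $$ (r, k)) =
       (\<Sum>r<m. \<Sum>i<n. \<Sum>j<n. cnj (X $$ (i, k)) * (cnj (M $$ (r, i)) * M $$ (r, j)) * X $$ (j, k))"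
      using k by (simp add: mult_mat_index[OF M X] sum_product del: index_mult_mat(1))
        (simp add: mult_ac)
    also have "\<dots> = (\<Sum>i<n. \<Sum>j<n. \<Sum>r<m. cnj (X $$ (i, k)) * (cnj (M $$ (r, i)) * M $$ (r, j)) * X $$ (j, k))"
      by (subst sum.swap) (intro sum.cong refl sum.swap)
    finally show "(\<Sum>r<m. cnj ((M * X) $$ (r, k)) * (M * X) $$ (r, k)) =
      (\<Sum>i<n. \<Sum>j<n. cnj (X $$ (i, k)) * (\<Sum>r<m. cnj (M $$ (r, i)) * M $$ (r, j)) * X $$ (j, k))"
      by (simp add: sum_distrib_left sum_distrib_right)
  qed
  finally show ?thesis using X by (simp add: herm_form_def gram)
qed

lemma herm_form_one: "herm_form (1\<^sub>m (dim_row X)) X = complex_of_real (state_norm_sq X)"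
proof -
  have "herm_form (1\<^sub>m (dim_row X)) X =
      (\<Sum>k<dim_col X. \<Sum>i<dim_row X. \<Sum>j<dim_row X. if j = i then cnj (X $$ (i, k)) * X $$ (i, k) else 0)"
    unfolding herm_form_def by (intro sum.cong refl) auto
  also have "\<dots> = (\<Sum>i<dim_row X. \<Sum>k<dim_col X. cnj (X $$ (i, k)) * X $$ (i, k))"
    by (subst sum.swap) simp
  finally show ?thesis by (simp add: state_norm_sq_def complex_norm_square mult.commute del: of_real_power)
qed

lemma herm_form_add:
  assumes "G \<in> carrier_mat (dim_row X) (dim_row X)" "H \<in> carrier_mat (dim_row X) (dim_row X)"
  shows "herm_form (G + H) X = herm_form G X + herm_form H X"
  using assms by (simp add: herm_form_def distrib_left distrib_right sum.distrib)

text \<open>Conservation of total weight: \<open>herm_form\<close> at the sum of the operators M^* M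
  gives the left side, and at the identity the right side. Later \<open>X\<close> is not a state but
  the operator accumulated by one party.\<close>

lemma local_measurement_norm_sq:
  assumes meas: "local_measurement n Ms" and X: "X \<in> carrier_mat n l"
  shows "(\<Sum>M\<leftarrow>Ms. state_norm_sq (M * X)) = state_norm_sq X"
proof -
  let ?S = "\<lambda>Ms. foldr (\<lambda>M S. mat_adjoint M * M + S) Ms (0\<^sub>m n n)"
  \<comment> \<open>The induction has to cover lists whose sum is not the identity; the carrier part
    is what allows \<open>herm_form_add\<close> to split off the next term.\<close>
  have "?S Ms \<in> carrier_mat n n \<and>
      herm_form (?S Ms) X = complex_of_real (\<Sum>M\<leftarrow>Ms. state_norm_sq (M * X))"
    if "\<forall>M\<in>set Ms. dim_col M = n"
    using that
  proof (induction Ms)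
    case Nil
    then show ?case using X by (simp add: herm_form_def)
  next
    case (Cons M Ms)
    then have M: "M \<in> carrier_mat (dim_row M) n" by auto
    have MM: "mat_adjoint M * M \<in> carrier_mat n n" using M by auto
    show ?case using Cons MM X herm_form_gram[OF M X] by (auto simp: herm_form_add)
  qed
  then have "complex_of_real (\<Sum>M\<leftarrow>Ms. state_norm_sq (M * X)) = complex_of_real (state_norm_sq X)"
    using meas X herm_form_one[of X] by (auto simp: local_measurement_def)
  then show ?thesis by (simp only: of_real_eq_iff)
qed

section \<open>LOCC protocols on partial isometries\<close>

lemma sum_sum_list_swap:
  fixes f :: "'a \<Rightarrow> 'b \<Rightarrow> real"
  shows "(\<Sum>r\<in>R. \<Sum>x\<leftarrow>xs. f r x) = (\<Sum>x\<leftarrow>xs. \<Sum>r\<in>R. f r x)"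
  by (induction xs) (simp_all add: sum.distrib)

text \<open>Induction over the protocol tree, with \<open>U r\<close> untouched in the middle while
  \<open>X\<close> and \<open>Y\<close> collect the operators of Alice and Bob. The bound has no
  factor for the size of \<open>R\<close>: a branch announces a single output, and its weight is
  bounded by a product that does not mention \<open>r\<close>. These products add up over the
  branches to the initial one.\<close>

lemma locc_sum_output_weight_le:
  assumes "locc_protocol d T" "finite R"
    and "X \<in> carrier_mat (d Alice) m" "Y \<in> carrier_mat (d Bob) n"
    and "\<And>r. r \<in> R \<Longrightarrow> U r \<in> carrier_mat m n"
    and "\<And>r. r \<in> R \<Longrightarrow> X * (U r * mat_adjoint (U r)) = X"
  shows "(\<Sum>r\<in>R. output_weight T (X * U r * transpose_mat Y) r) \<le> state_norm_sq X * state_norm_sq Y"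
  using assms
proof (induction arbitrary: X Y rule: locc_protocol.induct)
  case (1 d s)
  \<comment> \<open>At a leaf only the index equal to the announced output contributes.\<close>
  have "(\<Sum>r\<in>R. output_weight (Output s) (X * U r * transpose_mat Y) r) =
      (if s \<in> R then state_norm_sq (X * U s * transpose_mat Y) else 0)"
    using 1(1) by simp
  also have "\<dots> \<le> state_norm_sq X * state_norm_sq Y"
  proof (cases "s \<in> R")
    case True
    have XU: "X * U s \<in> carrier_mat (d Alice) n" using 1 True by auto
    have "state_norm_sq (X * U s * transpose_mat Y) \<le> state_norm_sq (X * U s) * state_norm_sq (transpose_mat Y)"
      by (rule state_norm_sq_mult_le[OF XU]) (use 1 in auto)
    \<comment> \<open>Here the dependence on \<open>U s\<close> disappears, since \<open>U s\<close>
      preserves the norm of \<open>X\<close>.\<close>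
    also have "\<dots> = state_norm_sq X * state_norm_sq Y"
      using state_norm_sq_mult_coisometry[OF 1(2) 1(4)[OF True] 1(5)[OF True]]
      by (simp add: state_norm_sq_transpose)
    finally show ?thesis using True by simp
  qed (simp add: state_norm_sq_nonneg)
  finally show ?case .
next
  case (2 d p bs)
  note meas = 2(1) and IH = 2(3) and R = 2(4) and X = 2(5) and Y = 2(6) and U = 2(7) and absorb = 2(8)
  \<comment> \<open>Outcome \<open>M\<close> multiplies the operator of the measuring party from the
    left and leaves the other one alone.\<close>
  define X' where "X' M = (if p = Alice then M * X else X)" for M
  define Y' where "Y' M = (if p = Bob then M * Y else Y)" for M
  have branch: "(\<Sum>r\<in>R. output_weight T (apply_local p M (X * U r * transpose_mat Y)) r)
      \<le> state_norm_sq (X' M) * state_norm_sq (Y' M)" if MT: "(M, T) \<in> set bs" for M T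
  proof -
    have M: "M \<in> carrier_mat (dim_row M) (d p)"
    proof -
      have "M \<in> set (map fst bs)" using MT by (metis fst_conv image_eqI list.set_map)
      then show ?thesis using meas unfolding local_measurement_def by blast
    qed
    have X': "X' M \<in> carrier_mat ((d(p := dim_row M)) Alice) m"
    proof (cases p)
      case Alice
      then show ?thesis using mult_carrier_mat[OF M, of X m] X by (simp add: X'_def)
    qed (simp add: X'_def X)
    have Y': "Y' M \<in> carrier_mat ((d(p := dim_row M)) Bob) n"
    proof (cases p)
      case Bob
      then show ?thesis using mult_carrier_mat[OF M, of Y n] Y by (simp add: Y'_def)
    qed (simp add: Y'_def Y)
    \<comment> \<open>Absorption takes place on the right of \<open>X\<close>, so multiplying from
      the left preserves it.\<close>
    have absorb': "X' M * (U r * mat_adjoint (U r)) = X' M" if r: "r \<in> R" for r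
    proof (cases p)
      case Alice
      have "M * X * (U r * mat_adjoint (U r)) = M * (X * (U r * mat_adjoint (U r)))"
        using M X U[OF r] Alice by (intro assoc_mult_mat) auto
      then show ?thesis using Alice absorb[OF r] by (simp add: X'_def)
    qed (simp add: X'_def absorb[OF r])
    have step: "apply_local p M (X * U r * transpose_mat Y) = X' M * U r * transpose_mat (Y' M)"
      if r: "r \<in> R" for r
    proof (cases p)
      case Alice
      have "M * (X * U r * transpose_mat Y) = M * (X * U r) * transpose_mat Y"
        using M X Y U[OF r] Alice by (intro assoc_mult_mat[symmetric]) auto
      also have "M * (X * U r) = M * X * U r"
        using M X U[OF r] Alice by (intro assoc_mult_mat[symmetric]) auto
      finally show ?thesis using Alice by (simp add: X'_def Y'_def)
    next
      case Bob
      have "X * U r * transpose_mat Y * transpose_mat M = X * U r * (transpose_mat Y * transpose_mat M)"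
        using M X Y U[OF r] Bob by (intro assoc_mult_mat) auto
      also have "transpose_mat Y * transpose_mat M = transpose_mat (M * Y)"
        using M Y Bob by (intro transpose_mult[symmetric]) auto
      finally show ?thesis using Bob by (simp add: X'_def Y'_def)
    qed
    have "(\<Sum>r\<in>R. output_weight T (X' M * U r * transpose_mat (Y' M)) r)
        \<le> state_norm_sq (X' M) * state_norm_sq (Y' M)"
      by (rule IH[OF MT R X' Y' U absorb'])
    then show ?thesis by (simp add: step cong: sum.cong)
  qed
  have "(\<Sum>r\<in>R. output_weight (Measure p bs) (X * U r * transpose_mat Y) r)
      = (\<Sum>(M, T)\<leftarrow>bs. \<Sum>r\<in>R. output_weight T (apply_local p M (X * U r * transpose_mat Y)) r)"
    unfolding output_weight.simps by (simp add: sum_sum_list_swap case_prod_unfold)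
  also have "\<dots> \<le> (\<Sum>(M, T)\<leftarrow>bs. state_norm_sq (X' M) * state_norm_sq (Y' M))"
    using branch by (intro sum_list_mono) auto
  also have "\<dots> = (\<Sum>M\<leftarrow>map fst bs. state_norm_sq (X' M) * state_norm_sq (Y' M))"
    by (simp add: case_prod_unfold comp_def)
  \<comment> \<open>The factor of the party that does not measure is constant over the outcomes; the
    other factor is summed by conservation of weight.\<close>
  also have "\<dots> = state_norm_sq X * state_norm_sq Y"
  proof (cases p)
    case Alice
    have "(\<Sum>M\<leftarrow>map fst bs. state_norm_sq (M * X)) = state_norm_sq X"
      using local_measurement_norm_sq[OF meas] X Alice by blast
    then show ?thesis using Alice by (simp add: X'_def Y'_def sum_list_mult_const comp_def)
  next
    case Bob
    have "(\<Sum>M\<leftarrow>map fst bs. state_norm_sq (M * Y)) = state_norm_sq Y"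
      using local_measurement_norm_sq[OF meas] Y Bob by blast
    then show ?thesis using Bob by (simp add: X'_def Y'_def sum_list_const_mult comp_def)
  qed
  finally show ?case .
qed

section \<open>Kronecker products\<close>

text \<open>The range is cut into \<open>m\<close> blocks of length \<open>n\<close>; the quotient
  names the block and the remainder the place in it. This is the index convention of
  \<open>kron\<close>.\<close>

lemma sum_div_mod:
  fixes f :: "nat \<Rightarrow> nat \<Rightarrow> 'a :: comm_monoid_add"
  shows "(\<Sum>k<m * n. f (k div n) (k mod n)) = (\<Sum>i<m. \<Sum>j<n. f i j)"
proof -
  have "(\<Sum>k=i * n..<i * n + n. f (k div n) (k mod n)) = (\<Sum>j<n. f i j)" for i
    by (subst sum.atLeastLessThan_shift_0) (auto simp: atLeast0LessThan intro!: sum.cong)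
  then show ?thesis
    using sum.nat_group[of "\<lambda>k. f (k div n) (k mod n)" n m] by simp
qed

lemma div_mod_less:
  assumes "(i :: nat) < m * n"
  shows "i div n < m" "i mod n < n"
  using assms by (auto simp: less_mult_imp_div_less intro!: mod_less_divisor gr0I)

lemma kron_dim [simp]:
  "dim_row (kron A B) = dim_row A * dim_row B" "dim_col (kron A B) = dim_col A * dim_col B"
  by (simp_all add: kron_def)

lemma kron_carrier:
  "A \<in> carrier_mat m n \<Longrightarrow> B \<in> carrier_mat m' n' \<Longrightarrow> kron A B \<in> carrier_mat (m * m') (n * n')"
  by (rule carrier_matI) (simp_all only: kron_dim carrier_matD)

lemma kron_index:
  assumes "i < dim_row A * dim_row B" "j < dim_col A * dim_col B"
  shows "kron A B $$ (i, j) =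
    A $$ (i div dim_row B, j div dim_col B) * B $$ (i mod dim_row B, j mod dim_col B)"
  using assms by (simp add: kron_def)

text \<open>The mixed-product rule: splitting the summation index into quotient and remainder makes
  the double sum a product of two sums.\<close>

lemma kron_mult:
  assumes A: "A \<in> carrier_mat a b" and B: "B \<in> carrier_mat a' b'"
    and C: "C \<in> carrier_mat b c" and D: "D \<in> carrier_mat b' c'"
  shows "kron A B * kron C D = kron (A * C) (B * D)"
proof (rule eq_matI)
  fix i j assume "i < dim_row (kron (A * C) (B * D))" "j < dim_col (kron (A * C) (B * D))"
  then have ij: "i < a * a'" "j < c * c'" using assms by auto
  note dm = div_mod_less[OF ij(1)] div_mod_less[OF ij(2)]
  have "(kron A B * kron C D) $$ (i, j) = (\<Sum>k<b * b'. kron A B $$ (i, k) * kron C D $$ (k, j))"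
    using assms ij by (intro mult_mat_index[where m = "a * a'" and l = "c * c'"]) auto
  also have "\<dots> = (\<Sum>k<b * b'. (A $$ (i div a', k div b') * B $$ (i mod a', k mod b')) *
      (C $$ (k div b', j div c') * D $$ (k mod b', j mod c')))"
    using assms ij by (intro sum.cong refl) (auto simp: kron_index)
  also have "\<dots> = (\<Sum>k<b. \<Sum>k'<b'. (A $$ (i div a', k) * B $$ (i mod a', k')) *
      (C $$ (k, j div c') * D $$ (k', j mod c')))"
    by (rule sum_div_mod)
  also have "\<dots> = (\<Sum>k<b. A $$ (i div a', k) * C $$ (k, j div c')) *
      (\<Sum>k'<b'. B $$ (i mod a', k') * D $$ (k', j mod c'))"
    by (simp add: sum_product mult_ac)
  also have "\<dots> = (A * C) $$ (i div a', j div c') * (B * D) $$ (i mod a', j mod c')"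
    using dm by (simp add: mult_mat_index[OF A C] mult_mat_index[OF B D] del: index_mult_mat(1))
  also have "\<dots> = kron (A * C) (B * D) $$ (i, j)"
    using assms ij by (subst kron_index) auto
  finally show "(kron A B * kron C D) $$ (i, j) = kron (A * C) (B * D) $$ (i, j)" .
qed (use assms in auto)

lemma kron_adjoint: "mat_adjoint (kron A B) = kron (mat_adjoint A) (mat_adjoint B)"
  by (rule eq_matI) (auto simp: kron_index div_mod_less)

lemma kron_transpose: "transpose_mat (kron A B) = kron (transpose_mat A) (transpose_mat B)"
  by (rule eq_matI) (auto simp: kron_index div_mod_less)

lemma state_norm_sq_kron: "state_norm_sq (kron A B) = state_norm_sq A * state_norm_sq B"
proof -
  let ?f = "\<lambda>i i' j j'. (cmod (A $$ (i, j)))\<^sup>2 * (cmod (B $$ (i', j')))\<^sup>2"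
  have "state_norm_sq (kron A B) = (\<Sum>i<dim_row A * dim_row B. \<Sum>j<dim_col A * dim_col B.
      ?f (i div dim_row B) (i mod dim_row B) (j div dim_col B) (j mod dim_col B))"
    by (simp add: state_norm_sq_def kron_index norm_mult power_mult_distrib)
  also have "\<dots> = (\<Sum>i<dim_row A. \<Sum>i'<dim_row B. \<Sum>j<dim_col A. \<Sum>j'<dim_col B. ?f i i' j j')"
    using sum_div_mod[of "\<lambda>i i'. \<Sum>j<dim_col A * dim_col B. ?f i i' (j div dim_col B) (j mod dim_col B)"
        "dim_row B" "dim_row A"]
    by (simp only: sum_div_mod[of "\<lambda>j j'. ?f i i' j j'" for i i'])
  also have "\<dots> = state_norm_sq A * state_norm_sq B"
    by (simp only: state_norm_sq_def sum_product)
  finally show ?thesis .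
qed

text \<open>The same fold as in \<open>shuffled_state\<close>. The rules below use lists
  \<open>map f xs\<close> so that factors sharing an index \<open>x\<close> can be combined.\<close>

definition krons :: "complex mat list \<Rightarrow> complex mat" where
  "krons As = foldr kron As (1\<^sub>m 1)"

lemma krons_simps [simp]: "krons [] = 1\<^sub>m 1" "krons (A # As) = kron A (krons As)"
  by (simp_all add: krons_def)

lemma krons_carrier:
  assumes "\<And>x. x \<in> set xs \<Longrightarrow> f x \<in> carrier_mat m n"
  shows "krons (map f xs) \<in> carrier_mat (m ^ length xs) (n ^ length xs)"
  using assms by (induction xs) (simp_all add: kron_carrier)

lemma krons_mult:
  assumes "\<And>x. x \<in> set xs \<Longrightarrow> f x \<in> carrier_mat l m" "\<And>x. x \<in> set xs \<Longrightarrow> g x \<in> carrier_mat m n"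
  shows "krons (map f xs) * krons (map g xs) = krons (map (\<lambda>x. f x * g x) xs)"
  using assms
proof (induction xs)
  case (Cons x xs)
  have "krons (map f (x # xs)) * krons (map g (x # xs)) =
      kron (f x * g x) (krons (map f xs) * krons (map g xs))"
    using Cons.prems krons_carrier[of xs f l m] krons_carrier[of xs g m n]
    by (simp add: kron_mult[where a = l and b = m and c = n and a' = "l ^ length xs"
        and b' = "m ^ length xs" and c' = "n ^ length xs"])
  then show ?case using Cons by simp
qed simp

lemma krons_adjoint: "mat_adjoint (krons (map f xs)) = krons (map (\<lambda>x. mat_adjoint (f x)) xs)"
proof (induction xs)
  case Nil
  show ?case by (auto intro!: eq_matI)
qed (simp add: kron_adjoint)

lemma krons_transpose: "transpose_mat (krons (map f xs)) = krons (map (\<lambda>x. transpose_mat (f x)) xs)"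
  by (induction xs) (simp_all add: kron_transpose)

lemma state_norm_sq_krons: "state_norm_sq (krons (map f xs)) = (\<Prod>x\<leftarrow>xs. state_norm_sq (f x))"
proof (induction xs)
  case Nil
  show ?case by (simp add: state_norm_sq_def)
qed (simp add: state_norm_sq_kron)

text \<open>A counting argument: perfect identification gives each of the n! orderings its full
  weight c^n, while the LOCC bound, started from tensor powers of \<open>P\<close> and
  \<open>Q\<close>, limits the sum of these weights. The support and coisometry conditions pass to
  the shuffled states factor by factor.\<close>

lemma locally_markable_bound:
  assumes mark: "locally_markable d \<chi>s"
    and P: "P \<in> carrier_mat (d Alice) (d Alice)" and Q: "Q \<in> carrier_mat (d Bob) (d Bob)"
    and \<chi>: "\<And>\<chi>. \<chi> \<in> set \<chi>s \<Longrightarrow> \<chi> \<in> carrier_mat (d Alice) (d Bob)"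
    and supp: "\<And>\<chi>. \<chi> \<in> set \<chi>s \<Longrightarrow> P * \<chi> * transpose_mat Q = \<chi>"
    and coiso: "\<And>\<chi>. \<chi> \<in> set \<chi>s \<Longrightarrow> P * (\<chi> * mat_adjoint \<chi>) = P"
    and norm: "\<And>\<chi>. \<chi> \<in> set \<chi>s \<Longrightarrow> state_norm_sq \<chi> = c" and c: "c > 0"
  shows "fact (length \<chi>s) * c ^ length \<chi>s \<le> (state_norm_sq P * state_norm_sq Q) ^ length \<chi>s"
proof -
  let ?n = "length \<chi>s" and ?R = "{\<pi>. \<pi> permutes {..<length \<chi>s}}"
  let ?X = "krons (map (\<lambda>_. P) [0..<length \<chi>s])" and ?Y = "krons (map (\<lambda>_. Q) [0..<length \<chi>s])"
  let ?U = "shuffled_state \<chi>s"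
  obtain T where T: "locc_protocol (\<lambda>p. d p ^ ?n) T"
    and prob: "\<And>\<pi>. \<pi> \<in> ?R \<Longrightarrow> output_prob T (?U \<pi>) \<pi> = 1"
    using mark by (auto simp: locally_markable_def)
  have U_def: "?U \<pi> = krons (map (\<lambda>i. \<chi>s ! \<pi> i) [0..<?n])" for \<pi>
    by (simp add: shuffled_state_def krons_def)
  have mem: "\<chi>s ! \<pi> i \<in> set \<chi>s" if "\<pi> \<in> ?R" "i \<in> set [0..<?n]" for \<pi> i
    using that permutes_in_image[of \<pi> "{..<?n}" i] by simp
  have X: "?X \<in> carrier_mat (d Alice ^ ?n) (d Alice ^ ?n)"
    using krons_carrier[of "[0..<?n]" "\<lambda>_. P"] P by simp
  have Y: "?Y \<in> carrier_mat (d Bob ^ ?n) (d Bob ^ ?n)"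
    using krons_carrier[of "[0..<?n]" "\<lambda>_. Q"] Q by simp
  have U: "?U \<pi> \<in> carrier_mat (d Alice ^ ?n) (d Bob ^ ?n)" if "\<pi> \<in> ?R" for \<pi>
    unfolding U_def using krons_carrier[of "[0..<?n]" "\<lambda>i. \<chi>s ! \<pi> i"] \<chi>[OF mem[OF that]] by simp
  \<comment> \<open>Having \<open>P\<close> in every slot makes the absorbing operator the same for
    all orderings.\<close>
  have absorb: "?X * (?U \<pi> * mat_adjoint (?U \<pi>)) = ?X" if \<pi>: "\<pi> \<in> ?R" for \<pi>
  proof -
    note C = \<chi>[OF mem[OF \<pi>]]
    have "?U \<pi> * mat_adjoint (?U \<pi>) = krons (map (\<lambda>i. \<chi>s ! \<pi> i * mat_adjoint (\<chi>s ! \<pi> i)) [0..<?n])"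
      unfolding U_def krons_adjoint
      by (rule krons_mult[where l = "d Alice" and m = "d Bob" and n = "d Alice"]) (use C in auto)
    moreover have "?X * krons (map (\<lambda>i. \<chi>s ! \<pi> i * mat_adjoint (\<chi>s ! \<pi> i)) [0..<?n])
        = krons (map (\<lambda>i. P * (\<chi>s ! \<pi> i * mat_adjoint (\<chi>s ! \<pi> i))) [0..<?n])"
      by (rule krons_mult[where l = "d Alice" and m = "d Alice" and n = "d Alice"])
        (use C P in \<open>auto intro!: mult_carrier_mat[where n = "d Bob"]\<close>)
    moreover have "\<dots> = ?X" by (intro arg_cong[where f = krons] map_cong refl coiso mem[OF \<pi>])
    ultimately show ?thesis by simp
  qed
  \<comment> \<open>This puts the true initial state into the form X U Y^T of the LOCC
    bound.\<close>
  have supp': "?X * ?U \<pi> * transpose_mat ?Y = ?U \<pi>" if \<pi>: "\<pi> \<in> ?R" for \<pi>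
  proof -
    note C = \<chi>[OF mem[OF \<pi>]]
    have "?X * ?U \<pi> = krons (map (\<lambda>i. P * \<chi>s ! \<pi> i) [0..<?n])"
      unfolding U_def
      by (rule krons_mult[where l = "d Alice" and m = "d Alice" and n = "d Bob"]) (use C P in auto)
    moreover have "krons (map (\<lambda>i. P * \<chi>s ! \<pi> i) [0..<?n]) * transpose_mat ?Y
        = krons (map (\<lambda>i. P * \<chi>s ! \<pi> i * transpose_mat Q) [0..<?n])"
      unfolding krons_transpose
      by (rule krons_mult[where l = "d Alice" and m = "d Bob" and n = "d Bob"]) (use C P Q in auto)
    moreover have "\<dots> = ?U \<pi>"
      unfolding U_def by (intro arg_cong[where f = krons] map_cong refl supp mem[OF \<pi>])
    ultimately show ?thesis by simp
  qed
  have normU: "state_norm_sq (?U \<pi>) = c ^ ?n" if "\<pi> \<in> ?R" for \<pi>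
  proof -
    have "state_norm_sq (?U \<pi>) = (\<Prod>i\<leftarrow>[0..<?n]. c)"
      unfolding U_def state_norm_sq_krons
      by (intro arg_cong[where f = prod_list] map_cong refl norm mem[OF that])
    then show ?thesis by (simp add: map_replicate_const)
  qed
  \<comment> \<open>Positivity of \<open>c\<close> makes the norm nonzero, so probability one means
    that the weight equals the norm.\<close>
  have weight: "output_weight T (?U \<pi>) \<pi> = c ^ ?n" if "\<pi> \<in> ?R" for \<pi>
    using prob[OF that] normU[OF that] c by (simp add: output_prob_def field_simps split: if_splits)
  have "fact ?n * c ^ ?n = (\<Sum>\<pi>\<in>?R. output_weight T (?U \<pi>) \<pi>)"
    using weight card_permutations[of "{..<?n}" ?n] by simp
  also have "\<dots> = (\<Sum>\<pi>\<in>?R. output_weight T (?X * ?U \<pi> * transpose_mat ?Y) \<pi>)"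
    using supp' by simp
  also have "\<dots> \<le> state_norm_sq ?X * state_norm_sq ?Y"
    by (rule locc_sum_output_weight_le[OF T _ X Y U absorb]) (auto intro: finite_permutations)
  also have "\<dots> = (state_norm_sq P * state_norm_sq Q) ^ ?n"
    unfolding state_norm_sq_krons by (simp add: map_replicate_const power_mult_distrib)
  finally show ?thesis .
qed

section \<open>Bell bases\<close>

lemma state_inner_add_left:
  assumes "\<phi> \<in> carrier_mat m n" "\<phi>' \<in> carrier_mat m n"
  shows "state_inner (\<phi> + \<phi>') \<psi> = state_inner \<phi> \<psi> + state_inner \<phi>' \<psi>"
  using assms by (simp add: state_inner_def sum.distrib distrib_right)

lemma state_inner_add_right:
  assumes "\<phi> \<in> carrier_mat m n" "\<psi> \<in> carrier_mat m n" "\<psi>' \<in> carrier_mat m n"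
  shows "state_inner \<phi> (\<psi> + \<psi>') = state_inner \<phi> \<psi> + state_inner \<phi> \<psi>'"
  using assms by (simp add: state_inner_def sum.distrib distrib_left)

lemma state_inner_diff_left:
  assumes "\<phi> \<in> carrier_mat m n" "\<phi>' \<in> carrier_mat m n"
  shows "state_inner (\<phi> - \<phi>') \<psi> = state_inner \<phi> \<psi> - state_inner \<phi>' \<psi>"
  using assms by (simp add: state_inner_def sum_subtractf left_diff_distrib)

lemma state_inner_diff_right:
  assumes "\<phi> \<in> carrier_mat m n" "\<psi> \<in> carrier_mat m n" "\<psi>' \<in> carrier_mat m n"
  shows "state_inner \<phi> (\<psi> - \<psi>') = state_inner \<phi> \<psi> - state_inner \<phi> \<psi>'"
  using assms by (simp add: state_inner_def sum_subtractf right_diff_distrib)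

lemma state_inner_smult_left:
  assumes "\<phi> \<in> carrier_mat m n"
  shows "state_inner (c \<cdot>\<^sub>m \<phi>) \<psi> = cnj c * state_inner \<phi> \<psi>"
  using assms by (simp add: state_inner_def sum_distrib_left mult.assoc)

lemma state_inner_smult_right:
  assumes "\<phi> \<in> carrier_mat m n" "\<psi> \<in> carrier_mat m n"
  shows "state_inner \<phi> (c \<cdot>\<^sub>m \<psi>) = c * state_inner \<phi> \<psi>"
  using assms by (simp add: state_inner_def sum_distrib_left mult.left_commute)

lemma nonzero_state_if_inner_neq_0:
  assumes "state_inner \<psi> \<psi> \<noteq> 0"
  shows "\<psi> \<noteq> 0\<^sub>m m n"
  using assms by (auto simp: state_inner_def)

lemma state_norm_sq_eq_inner: "complex_of_real (state_norm_sq \<psi>) = state_inner \<psi> \<psi>"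
  by (simp add: state_norm_sq_def state_inner_def complex_norm_square mult.commute del: of_real_power)

lemma orthogonal_states_Nil [simp]: "orthogonal_states d []"
  by (simp add: orthogonal_states_def)

lemma orthogonal_states_Cons [simp]:
  "orthogonal_states d (\<chi> # \<chi>s) \<longleftrightarrow>
     \<chi> \<in> carrier_mat (d Alice) (d Bob) \<and> \<chi> \<noteq> 0\<^sub>m (d Alice) (d Bob) \<and>
     (\<forall>\<phi>\<in>set \<chi>s. state_inner \<chi> \<phi> = 0 \<and> state_inner \<phi> \<chi> = 0) \<and> orthogonal_states d \<chi>s"
  unfolding orthogonal_states_def by (auto simp: All_less_Suc2 all_set_conv_all_nth)

lemma ket_carrier [simp]: "ket a b \<in> carrier_mat 4 4"
  by (simp add: ket_def)

lemma ket_dim [simp]: "dim_row (ket a b) = 4" "dim_col (ket a b) = 4"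
  by (simp_all add: ket_def)

lemma ket_index [simp]:
  "i < 4 \<Longrightarrow> j < 4 \<Longrightarrow> ket a b $$ (i, j) = (if i = a \<and> j = b then 1 else 0)"
  by (simp add: ket_def)

lemma state_inner_ket:
  assumes "a < 4" "b < 4"
  shows "state_inner (ket a b) (ket c d) = (if a = c \<and> b = d then 1 else 0)"
proof -
  have "state_inner (ket a b) (ket c d) =
      (\<Sum>i<4. \<Sum>j<4. if j = b then (if i = a then (if a = c \<and> b = d then 1 else 0) else 0) else 0)"
    unfolding state_inner_def ket_dim by (intro sum.cong refl) auto
  then show ?thesis using assms by simp
qed

lemmas state_inner_ket_simps =
  state_inner_add_left[of _ 4 4] state_inner_add_right[of _ 4 4]
  state_inner_diff_left[of _ 4 4] state_inner_diff_right[of _ 4 4]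
  state_inner_smult_left[of _ 4 4] state_inner_smult_right[of _ 4 4] minus_carrier_mat[of _ 4 4] state_inner_ket

section \<open>Coordinate projections\<close>

definition coord_proj :: "nat set \<Rightarrow> complex mat" where
  "coord_proj A = mat 4 4 (\<lambda>(i, j). if i = j \<and> i \<in> A then 1 else 0)"

lemma coord_proj_carrier [simp]: "coord_proj A \<in> carrier_mat 4 4"
  by (simp add: coord_proj_def)

lemma coord_proj_dim [simp]: "dim_row (coord_proj A) = 4" "dim_col (coord_proj A) = 4"
  by (simp_all add: coord_proj_def)

lemma coord_proj_index [simp]:
  "i < 4 \<Longrightarrow> j < 4 \<Longrightarrow> coord_proj A $$ (i, j) = (if i = j \<and> i \<in> A then 1 else 0)"
  by (simp add: coord_proj_def)

lemma coord_proj_mult: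
  assumes "\<psi> \<in> carrier_mat 4 4"
  shows "coord_proj A * \<psi> = mat 4 4 (\<lambda>(i, j). if i \<in> A then \<psi> $$ (i, j) else 0)"
proof (rule eq_matI)
  fix i j assume "i < dim_row (mat 4 4 (\<lambda>(i, j). if i \<in> A then \<psi> $$ (i, j) else 0))"
    "j < dim_col (mat 4 4 (\<lambda>(i, j). if i \<in> A then \<psi> $$ (i, j) else 0))"
  then have ij: "i < 4" "j < 4" by auto
  have "(coord_proj A * \<psi>) $$ (i, j) = (\<Sum>k<4. coord_proj A $$ (i, k) * \<psi> $$ (k, j))"
    by (rule mult_mat_index[OF coord_proj_carrier assms ij])
  also have "\<dots> = (\<Sum>k<4. if k = i then (if i \<in> A then \<psi> $$ (i, j) else 0) else 0)"
    using ij by (intro sum.cong refl) auto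
  finally show "(coord_proj A * \<psi>) $$ (i, j) =
      mat 4 4 (\<lambda>(i, j). if i \<in> A then \<psi> $$ (i, j) else 0) $$ (i, j)"
    using ij by simp
qed (use assms in auto)

lemma transpose_coord_proj [simp]: "transpose_mat (coord_proj A) = coord_proj A"
  by (rule eq_matI) auto

text \<open>Transposition reduces the selection of columns to that of rows.\<close>

lemma mult_coord_proj:
  assumes "\<psi> \<in> carrier_mat 4 4"
  shows "\<psi> * coord_proj A = mat 4 4 (\<lambda>(i, j). if j \<in> A then \<psi> $$ (i, j) else 0)"
proof -
  have "transpose_mat (\<psi> * coord_proj A) = coord_proj A * transpose_mat \<psi>"
    using transpose_mult[OF assms coord_proj_carrier[of A]] by simp
  also have "\<dots> = mat 4 4 (\<lambda>(i, j). if i \<in> A then transpose_mat \<psi> $$ (i, j) else 0)"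
    using assms by (intro coord_proj_mult) simp
  finally have "\<psi> * coord_proj A =
      transpose_mat (mat 4 4 (\<lambda>(i, j). if i \<in> A then transpose_mat \<psi> $$ (i, j) else 0))"
    by (metis transpose_transpose)
  also have "\<dots> = mat 4 4 (\<lambda>(i, j). if j \<in> A then \<psi> $$ (i, j) else 0)"
    using assms by (intro eq_matI) auto
  finally show ?thesis .
qed

lemma adjoint_coord_proj [simp]: "mat_adjoint (coord_proj A) = coord_proj A"
  by (rule eq_matI) auto

lemma coord_proj_idem: "coord_proj A * coord_proj A = coord_proj A"
  by (subst coord_proj_mult) (auto intro!: eq_matI)

text \<open>A coordinate projection is self-adjoint and idempotent, so M^* M = M, and complementary
  projections add up to the identity.\<close>

lemma local_measurement_coord_proj:
  assumes "A \<union> B = {..<4}" "A \<inter> B = {}"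
  shows "local_measurement 4 [coord_proj A, coord_proj B]"
  using assms by (auto simp: local_measurement_def coord_proj_idem intro!: eq_matI)

text \<open>For a \<noteq> c, b \<noteq> d and phases \<open>s\<close>, \<open>t\<close> this is a
  Bell state, up to normalization, of the qubits with levels \<open>a\<close>, \<open>c\<close> for
  Alice and \<open>b\<close>, \<open>d\<close> for Bob.\<close>

definition two_ket :: "complex \<Rightarrow> nat \<Rightarrow> nat \<Rightarrow> complex \<Rightarrow> nat \<Rightarrow> nat \<Rightarrow> bistate" where
  "two_ket s a b t c d = s \<cdot>\<^sub>m ket a b + t \<cdot>\<^sub>m ket c d"

lemma two_ket_carrier [simp]: "two_ket s a b t c d \<in> carrier_mat 4 4"
  by (simp add: two_ket_def)

lemma two_ket_dim [simp]: "dim_row (two_ket s a b t c d) = 4" "dim_col (two_ket s a b t c d) = 4"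
  by (simp_all add: two_ket_def)

lemma two_ket_supp:
  "coord_proj {a, c} * two_ket s a b t c d * transpose_mat (coord_proj {b, d}) = two_ket s a b t c d"
  by (simp add: coord_proj_mult mult_coord_proj) (auto simp: two_ket_def intro!: eq_matI)

text \<open>Maximal entanglement: the coefficient matrix is a partial isometry whose final
  projection depends on Alice's levels only, not on the phases.\<close>

lemma two_ket_gram:
  assumes "a < 4" "b < 4" "c < 4" "d < 4" "a \<noteq> c" "b \<noteq> d" "cmod s = 1" "cmod t = 1"
  shows "two_ket s a b t c d * mat_adjoint (two_ket s a b t c d) = coord_proj {a, c}"
proof (rule eq_matI)
  let ?\<psi> = "two_ket s a b t c d"
  have st: "s * cnj s = 1" "t * cnj t = 1"
    using assms by (simp_all add: complex_norm_square[symmetric])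
  fix i j assume "i < dim_row (coord_proj {a, c})" "j < dim_col (coord_proj {a, c})"
  then have ij: "i < 4" "j < 4" by auto
  have "(?\<psi> * mat_adjoint ?\<psi>) $$ (i, j) = (\<Sum>k<4. ?\<psi> $$ (i, k) * mat_adjoint ?\<psi> $$ (k, j))"
    by (rule mult_mat_index[OF two_ket_carrier mat_adjoint_carrier[OF two_ket_carrier] ij])
  \<comment> \<open>As b \<noteq> d, column \<open>b\<close> holds only the entry in row
    \<open>a\<close> and column \<open>d\<close> only the one in row \<open>c\<close>, so no cross
    terms arise.\<close>
  also have "\<dots> = (\<Sum>k<4. (if k = b then (if i = a \<and> j = a then 1 else 0) else 0) +
      (if k = d then (if i = c \<and> j = c then 1 else 0) else 0))"
    using assms ij st by (intro sum.cong refl) (auto simp: two_ket_def)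
  also have "\<dots> = coord_proj {a, c} $$ (i, j)"
    using assms ij by (auto simp: sum.distrib)
  finally show "(?\<psi> * mat_adjoint ?\<psi>) $$ (i, j) = coord_proj {a, c} $$ (i, j)" .
qed auto

lemma state_norm_sq_coord_proj:
  assumes "a < 4" "b < 4" "a \<noteq> b"
  shows "state_norm_sq (coord_proj {a, b}) = 2"
proof -
  have "state_norm_sq (coord_proj {a, b}) =
      (\<Sum>i<4. \<Sum>j<4. if j = i then (if i = a then 1 else 0) + (if i = b then 1 else 0) else 0)"
    unfolding state_norm_sq_def coord_proj_dim using assms by (intro sum.cong refl) auto
  then show ?thesis using assms by (simp add: sum.distrib)
qed

text \<open>The first two states share no ket with the last two, and within each pair the phases
  give orthogonality. All four have squared norm 2 and the same two support projections, also of
  squared norm 2, so marking would require 4! * 2^4 \<le> 4^4, that is 384 \<le> 256.\<close>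

lemma bell_basis_unmarkable:
  assumes dim: "a < 4" "b < 4" "c < 4" "d < 4" and neq: "a \<noteq> c" "b \<noteq> d"
    and phase: "cmod s1 = 1" "cmod t1 = 1" "cmod s2 = 1" "cmod t2 = 1"
      "cmod s3 = 1" "cmod t3 = 1" "cmod s4 = 1" "cmod t4 = 1"
    and orth: "cnj s1 * s2 + cnj t1 * t2 = 0" "cnj s3 * s4 + cnj t3 * t4 = 0"
  shows "locally_unmarkable (\<lambda>_. 4)
    [two_ket s1 a b t1 c d, two_ket s2 a b t2 c d, two_ket s3 a d t3 c b, two_ket s4 a d t4 c b]"
    (is "locally_unmarkable _ ?\<chi>s")
proof -
  have orth': "cnj s2 * s1 + cnj t2 * t1 = 0" "cnj s4 * s3 + cnj t4 * t3 = 0"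
    using orth[THEN arg_cong[where f = cnj]] by (simp_all add: mult.commute)
  have inner: "state_inner (two_ket s a b t c d) (two_ket s' a b t' c d) = cnj s * s' + cnj t * t'"
    "state_inner (two_ket s a d t c b) (two_ket s' a d t' c b) = cnj s * s' + cnj t * t'"
    "state_inner (two_ket s a b t c d) (two_ket s' a d t' c b) = 0"
    "state_inner (two_ket s a d t c b) (two_ket s' a b t' c d) = 0" for s t s' t'
    using dim neq by (simp_all add: two_ket_def state_inner_ket_simps)
  have norm: "state_norm_sq \<chi> = 2" if "\<chi> \<in> set ?\<chi>s" for \<chi>
  proof -
    have "cnj z * z = 1" if "cmod z = 1" for z
      using that by (simp add: complex_norm_square[symmetric] mult.commute[of "cnj z"])
    then have "complex_of_real (state_norm_sq \<chi>) = complex_of_real 2"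
      using that phase by (auto simp: state_norm_sq_eq_inner inner)
    then show ?thesis by (simp only: of_real_eq_iff)
  qed
  have "state_inner \<chi> \<chi> \<noteq> 0" if "\<chi> \<in> set ?\<chi>s" for \<chi>
    using norm[OF that] by (simp flip: state_norm_sq_eq_inner)
  then have "orthogonal_states (\<lambda>_. 4) ?\<chi>s"
    using orth orth' by (auto simp: inner dest!: nonzero_state_if_inner_neq_0)
  moreover have "\<not> locally_markable (\<lambda>_. 4) ?\<chi>s"
  proof
    assume "locally_markable (\<lambda>_. 4) ?\<chi>s"
    then have "fact (length ?\<chi>s) * 2 ^ length ?\<chi>s
        \<le> (state_norm_sq (coord_proj {a, c}) * state_norm_sq (coord_proj {b, d})) ^ length ?\<chi>s"
    proof (rule locally_markable_bound)
      fix \<chi> assume \<chi>: "\<chi> \<in> set ?\<chi>s"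
      show "coord_proj {a, c} * \<chi> * transpose_mat (coord_proj {b, d}) = \<chi>"
        \<comment> \<open>The last two states pair Bob's levels the other way round, but span the
          same set of levels.\<close>
        using \<chi> two_ket_supp[of a c _ b _ d] two_ket_supp[of a c _ d _ b] by (auto simp: insert_commute)
      have "\<chi> * mat_adjoint \<chi> = coord_proj {a, c}"
        using \<chi> dim neq phase by (auto intro!: two_ket_gram)
      then show "coord_proj {a, c} * (\<chi> * mat_adjoint \<chi>) = coord_proj {a, c}"
        by (simp add: coord_proj_idem)
    qed (use norm in auto)
    then show False
      using dim neq by (simp add: state_norm_sq_coord_proj fact_numeral)
  qed
  ultimately show ?thesis by (simp add: locally_unmarkable_def)
qed

section \<open>Conversion of S4\<close>

lemma post_states_append: "post_states p M (\<chi>s @ \<phi>s) = post_states p M \<chi>s @ post_states p M \<phi>s"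
  by (simp add: post_states_def)

lemma post_states_eq_map:
  assumes "map (apply_local p M) \<chi>s = \<phi>s" "\<And>\<phi>. \<phi> \<in> set \<phi>s \<Longrightarrow> \<phi> \<noteq> 0\<^sub>m (dim_row \<phi>) (dim_col \<phi>)"
  shows "post_states p M \<chi>s = \<phi>s"
  using assms by (simp add: post_states_def)

lemma post_states_eq_Nil:
  assumes "\<And>\<chi>. \<chi> \<in> set \<chi>s \<Longrightarrow> apply_local p M \<chi> = 0\<^sub>m m n"
  shows "post_states p M \<chi>s = []"
  using assms by (simp add: post_states_def filter_empty_conv)

lemma S4_halves:
  "take 4 S4 =
    [ket 0 0 + ket 0 2 + ket 3 1 - ket 3 3, ket 0 0 - ket 0 2 - ket 3 1 - ket 3 3,
     ket 0 1 - ket 3 2 - ket 3 0 - ket 0 3, ket 0 1 + ket 3 2 + ket 3 0 - ket 0 3]"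
  "drop 4 S4 =
    [ket 1 0 + ket 1 2 + ket 2 1 - ket 2 3, ket 1 0 + ket 1 2 - ket 2 1 + ket 2 3,
     ket 1 1 - ket 2 2 + ket 2 0 + ket 1 3, ket 1 1 - ket 2 2 - ket 2 0 - ket 1 3]"
  by (simp_all add: S4_def)

text \<open>The first four states use Alice's levels 0 and 3 only, the last four 1 and 2. Each
  projection therefore fixes one half and annihilates the other, which is then eliminated.\<close>

lemma post_states_Alice:
  "post_states Alice (coord_proj {0, 3}) S4 = take 4 S4"
  "post_states Alice (coord_proj {1, 2}) S4 = drop 4 S4"
proof -
  have nonzero: "\<chi> \<noteq> 0\<^sub>m (dim_row \<chi>) (dim_col \<chi>)" if "\<chi> \<in> set (take 4 S4) \<or> \<chi> \<in> set (drop 4 S4)" for \<chi>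
    using that unfolding S4_halves
    by (intro nonzero_state_if_inner_neq_0) (auto simp: state_inner_ket_simps)
  have keep: "map (apply_local Alice (coord_proj {0, 3})) (take 4 S4) = take 4 S4"
    "map (apply_local Alice (coord_proj {1, 2})) (drop 4 S4) = drop 4 S4"
    unfolding S4_halves
    by (auto simp: coord_proj_mult minus_carrier_mat[of _ 4 4] intro!: eq_matI)
  have kill: "apply_local Alice (coord_proj {1, 2}) \<chi> = 0\<^sub>m 4 4" if "\<chi> \<in> set (take 4 S4)" for \<chi>
    using that unfolding S4_halves
    by (auto simp: coord_proj_mult minus_carrier_mat[of _ 4 4] intro!: eq_matI)
  have kill': "apply_local Alice (coord_proj {0, 3}) \<chi> = 0\<^sub>m 4 4" if "\<chi> \<in> set (drop 4 S4)" for \<chi>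
    using that unfolding S4_halves
    by (auto simp: coord_proj_mult minus_carrier_mat[of _ 4 4] intro!: eq_matI)
  have split: "post_states p M S4 = post_states p M (take 4 S4) @ post_states p M (drop 4 S4)" for p M
    by (simp flip: post_states_append)
  show "post_states Alice (coord_proj {0, 3}) S4 = take 4 S4"
    using post_states_eq_map[OF keep(1)] post_states_eq_Nil[OF kill'] nonzero
    by (simp add: split)
  show "post_states Alice (coord_proj {1, 2}) S4 = drop 4 S4"
    using post_states_eq_map[OF keep(2)] post_states_eq_Nil[OF kill] nonzero
    by (simp add: split)
qed

lemma orthogonal_states_S4_halves:
  "orthogonal_states (\<lambda>_. 4) (take 4 S4)" "orthogonal_states (\<lambda>_. 4) (drop 4 S4)"
  by (simp_all add: S4_halves nonzero_state_if_inner_neq_0 state_inner_ket_simps)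

lemma two_ket_nonzero:
  assumes "a < 4" "b < 4" "a \<noteq> c" "s \<noteq> 0"
  shows "two_ket s a b t c d \<noteq> 0\<^sub>m 4 4"
proof
  assume "two_ket s a b t c d = 0\<^sub>m 4 4"
  then have "two_ket s a b t c d $$ (a, b) = 0" using assms by simp
  then show False using assms by (simp add: two_ket_def)
qed

text \<open>Bob's projection keeps two of the four terms of each state. In every list the first two
  states pair the levels one way and the last two crosswise, in the order expected by
  \<open>bell_basis_unmarkable\<close>.\<close>

lemma map_apply_local_Bob:
  "map (apply_local Bob (coord_proj {0, 1})) (take 4 S4) =
    [two_ket 1 0 0 1 3 1, two_ket 1 0 0 (-1) 3 1, two_ket 1 0 1 (-1) 3 0, two_ket 1 0 1 1 3 0]"
  "map (apply_local Bob (coord_proj {2, 3})) (take 4 S4) =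
    [two_ket 1 0 2 (-1) 3 3, two_ket (-1) 0 2 (-1) 3 3,
     two_ket (-1) 0 3 (-1) 3 2, two_ket (-1) 0 3 1 3 2]"
  "map (apply_local Bob (coord_proj {0, 1})) (drop 4 S4) =
    [two_ket 1 1 0 1 2 1, two_ket 1 1 0 (-1) 2 1, two_ket 1 1 1 1 2 0, two_ket 1 1 1 (-1) 2 0]"
  "map (apply_local Bob (coord_proj {2, 3})) (drop 4 S4) =
    [two_ket 1 1 2 (-1) 2 3, two_ket 1 1 2 1 2 3,
     two_ket 1 1 3 (-1) 2 2, two_ket (-1) 1 3 (-1) 2 2]"
  unfolding S4_halves
  by (auto simp: mult_coord_proj two_ket_def minus_carrier_mat[of _ 4 4] intro!: eq_matI)

text \<open>Every projected state keeps nonzero coefficients, so Bob eliminates no state.\<close>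

lemma post_states_Bob:
  assumes "M \<in> {coord_proj {0, 1}, coord_proj {2, 3}}" "\<chi>s \<in> {take 4 S4, drop 4 S4}"
  shows "post_states Bob M \<chi>s = map (apply_local Bob M) \<chi>s"
  using assms
  by (intro post_states_eq_map refl)
    (auto simp: map_apply_local_Bob two_ket_nonzero simp del: One_nat_def set_map list.set_map)

theorem theorem4:
  shows "deterministically_convertible (\<lambda>_. 4) (locally_unmarkable (\<lambda>_. 4)) S4"
proof -
  let ?PA = "[coord_proj {0, 3}, coord_proj {1, 2}]" and ?PB = "[coord_proj {0, 1}, coord_proj {2, 3}]"
  have meas: "local_measurement 4 ?PA" "local_measurement 4 ?PB"
    by (rule local_measurement_coord_proj; auto)+
  have unmarkable: "locally_unmarkable (\<lambda>_. 4) (post_states Bob M \<chi>s)"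
    if "M \<in> set ?PB" "\<chi>s \<in> {take 4 S4, drop 4 S4}" for M \<chi>s
    using that
    by (auto simp: post_states_Bob map_apply_local_Bob simp del: One_nat_def
        intro!: bell_basis_unmarkable)
  \<comment> \<open>For Alice, orthogonality is that of the two halves; for Bob, it is contained in
    \<open>locally_unmarkable\<close>.\<close>
  have "converts_via (\<lambda>_. 4) (locally_unmarkable (\<lambda>_. 4)) [(Alice, ?PA), (Bob, ?PB)] S4"
    using meas unmarkable orthogonal_states_S4_halves
    by (auto simp: local_opm_def post_states_Alice locally_unmarkable_def simp del: One_nat_def)
  then show ?thesis unfolding deterministically_convertible_def by blast
qed

end
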